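(* Let $B_k = (2^{k-1},2^k] \cap \mathbb{Z}^+$ for $k \ge 1$ and $S_{\mathrm A} = \bigcup_{k \ge 2,\ k \text{ even}} B_k$. In any $3$-AP-free permutation of $S_{\mathrm A}$, infinitely many of the blocks $B_{2k}$ ($k \ge 1$) are not placed as contiguous runs.
   Context: $\mathbb{N} = \{1,2,3,\dots\} = \mathbb{Z}^+$. A $3$-AP-free permutation of a set $S \subseteq \mathbb{Z}^+$ is a bijection $\pi\colon\mathbb{N} \to S$ such that no $i<j<k$ have $\pi(i),\pi(j),\pi(k)$ forming an arithmetic progression with $\pi(i)<\pi(j)<\pi(k)$ or $\pi(i)>\pi(j)>\pi(k)$. A finite set $B \subseteq S$ is placed as a contiguous run if $\pi^{-1}(B)$ is a set of consecutive positions. *)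

theory Defs
  imports Main
begin

definition three_ap :: "nat \<Rightarrow> nat \<Rightarrow> nat \<Rightarrow> bool" where
  "three_ap a b c \<longleftrightarrow> (\<exists>d::int. int b = int a + d \<and> int c = int a + 2 * d)"

(* Positions are the positive integers; the value of p at 0 is irrelevant. *)
definition three_ap_free_perm :: "(nat \<Rightarrow> nat) \<Rightarrow> nat set \<Rightarrow> bool" where
  "three_ap_free_perm p S \<longleftrightarrow>
     S \<subseteq> {1..} \<and> bij_betw p {1..} S \<and>
     \<not> (\<exists>i j k. 1 \<le> i \<and> i < j \<and> j < k \<and> three_ap (p i) (p j) (p k) \<and>
          (p i < p j \<and> p j < p k \<or> p i > p j \<and> p j > p k))"

definition contiguous_run :: "(nat \<Rightarrow> nat) \<Rightarrow> nat set \<Rightarrow> bool" where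
  "contiguous_run p B \<longleftrightarrow> (\<exists>a b. {i \<in> {1..}. p i \<in> B} = {a..b})"

(* Only used for k at least 1. *)
definition block :: "nat \<Rightarrow> nat set" where
  "block k = {2 ^ (k - 1)<..2 ^ k}"

definition S_A :: "nat set" where
  "S_A = (\<Union>k\<in>{k. 2 \<le> k \<and> even k}. block k)"

end

theory Submission
  imports Defs
begin

text \<open>
  For \<open>k \<ge> 3\<close> the blocks \<open>B\<^bsub>2k-2\<^esub>\<close> and \<open>B\<^bsub>2k\<^esub>\<close> cannot both be contiguous runs. Otherwise one
  of them lies entirely before the other. If \<open>a \<in> B\<^bsub>2k-2\<^esub>\<close> and \<open>b < c = 2b - a\<close> are in \<open>B\<^bsub>2k\<^esub>\<close>,
  the relative order of \<open>b\<close> and \<open>c\<close> is then forced, in the same direction for all such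
  triples. With \<open>e = 2\<^bsup>2k-5\<^esup>\<close> the two blocks are \<open>(4e, 8e]\<close> and \<open>(16e, 32e]\<close>, and the
  multiples of \<open>e\<close> in them already yield a contradiction, independent of \<open>e\<close>: the middle
  term of a progression inside \<open>B\<^bsub>2k\<^esub>\<close> comes before both or after both of the other terms,
  and this is incompatible with the forced relations.
\<close>

text \<open>
  Here \<open>q i\<close> stands for the position of \<open>i * e\<close>, negated if \<open>B\<^bsub>2k\<^esub>\<close> comes first. The case
  splits and the progressions they use were found by a computer search.
\<close>

lemma no_ranking:
  fixes q :: "nat \<Rightarrow> int"
  assumes ne: "q 17 \<noteq> q 24" "q 17 \<noteq> q 19"
    and mid: "\<And>x d. \<lbrakk>17 \<le> x; 0 < d; x + 2 * d \<le> 32\<rbrakk> \<Longrightarrow>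
      q x < q (x + d) \<and> q (x + 2 * d) < q (x + d) \<or> q (x + d) < q x \<and> q (x + d) < q (x + 2 * d)"
    and low: "\<And>a b. \<lbrakk>5 \<le> a; a \<le> 8; 17 \<le> b; 2 * b - a \<le> 32\<rbrakk> \<Longrightarrow> q (2 * b - a) < q b"
  shows False
proof -
  \<comment> \<open>By \<open>low\<close>, 26, 27 and 28 rank below 17, hence below 24. So
    \<open>mid\<close> on progressions starting at 24 makes them low points, giving
    \<open>q 26 < q 28\<close> and \<open>q 28 < q 32\<close>.\<close>
  have le_24: "\<not> (q 17 < q 24)"
    using mid[of 17 4] mid[of 17 6] mid[of 19 4] mid[of 19 6] mid[of 21 4]
      mid[of 21 5] mid[of 23 2] mid[of 23 3] mid[of 23 4] mid[of 24 2]
      mid[of 24 3] mid[of 24 4] mid[of 25 1] mid[of 26 1] mid[of 26 2]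
      mid[of 26 3] mid[of 27 1] low[of 8 17] low[of 7 17] low[of 6 17]
      low[of 6 19]
    by simp (smt (verit))
  have not_17_19: "\<not> (q 24 < q 17 \<and> q 17 < q 19)"
    using mid[of 17 2] mid[of 18 7] mid[of 19 2] mid[of 19 3] mid[of 19 5]
      mid[of 19 6] mid[of 20 4] mid[of 21 1] mid[of 21 2] mid[of 21 3]
      mid[of 22 1] mid[of 22 3] mid[of 23 1] mid[of 23 2] mid[of 24 4]
      mid[of 25 2] low[of 7 17] low[of 5 18] low[of 8 20]
    by simp (smt (verit))
  have not_19_17: "\<not> (q 24 < q 17 \<and> q 19 < q 17)"
    using mid[of 17 2] mid[of 17 4] mid[of 17 5] mid[of 17 6] mid[of 17 7]
      mid[of 18 4] mid[of 18 5] mid[of 18 6] mid[of 18 7] mid[of 19 2]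
      mid[of 19 3] mid[of 20 5] mid[of 21 2] mid[of 21 3] mid[of 21 4]
      mid[of 22 1] mid[of 22 4] mid[of 23 1] mid[of 23 2] mid[of 23 3]
      mid[of 24 1] mid[of 24 2] mid[of 24 3] mid[of 25 1] mid[of 25 2]
      low[of 7 18] low[of 5 18] low[of 7 19] low[of 8 20]
    by simp (smt (verit))
  show False
    using ne le_24 not_17_19 not_19_17 by linarith
qed

lemma contiguous_runs_ordered:
  assumes "contiguous_run p A" "contiguous_run p B" "A \<inter> B = {}"
  shows "(\<forall>i\<ge>1. \<forall>j\<ge>1. p i \<in> A \<longrightarrow> p j \<in> B \<longrightarrow> i < j) \<or>
    (\<forall>i\<ge>1. \<forall>j\<ge>1. p i \<in> A \<longrightarrow> p j \<in> B \<longrightarrow> j < i)"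
proof -
  obtain a b c d where A: "{i \<in> {1..}. p i \<in> A} = {a..b}"
    and B: "{i \<in> {1..}. p i \<in> B} = {c..d}"
    using assms(1,2) unfolding contiguous_run_def by blast
  have iA: "i \<in> {a..b} \<longleftrightarrow> 1 \<le> i \<and> p i \<in> A" for i
    unfolding A[symmetric] by simp
  have iB: "i \<in> {c..d} \<longleftrightarrow> 1 \<le> i \<and> p i \<in> B" for i
    unfolding B[symmetric] by simp
  have "{a..b} \<inter> {c..d} = {}"
    using iA iB assms(3) by blast
  then have "b < a \<or> d < c \<or> b < c \<or> d < a"
    by auto
  then show ?thesis
    using iA iB by (metis atLeastAtMost_iff le_trans linorder_not_le)
qed

lemma block_subset_S_A: "1 \<le> k \<Longrightarrow> block (2 * k) \<subseteq> S_A"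
  unfolding S_A_def by (rule UN_upper) simp

lemma consecutive_blocks_not_both_contiguous:
  assumes perm: "three_ap_free_perm p S_A"
    and cont: "contiguous_run p (block (2 * (m + 2)))" "contiguous_run p (block (2 * (m + 3)))"
  shows False
proof -
  \<comment> \<open>The offsets 2 and 3 keep \<open>e\<close> integral; the pair
    \<open>block 2\<close>, \<open>block 4\<close> would need e = 1/2.\<close>
  define e :: nat where "e = 2 ^ (2 * m + 1)"
  have e: "0 < e"
    by (simp add: e_def)
  have L: "block (2 * (m + 2)) = {4 * e<..8 * e}" and H: "block (2 * (m + 3)) = {16 * e<..32 * e}"
    by (simp_all add: block_def e_def power_add mult.commute[of "2 ^ (2 * m)"])
  have sub: "{4 * e<..8 * e} \<subseteq> S_A" "{16 * e<..32 * e} \<subseteq> S_A"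
    using block_subset_S_A[of "m + 2"] block_subset_S_A[of "m + 3"] L H by auto
  have bij: "bij_betw p {1..} S_A"
    using perm by (simp add: three_ap_free_perm_def)
  \<comment> \<open>\<open>r\<close> gives the position of a value; it is unspecified outside
    \<open>S_A\<close>, so membership is tracked throughout.\<close>
  define r where "r = inv_into {1..} p"
  have r: "1 \<le> r v" "p (r v) = v" if "v \<in> S_A" for v
    using that bij inv_into_into[of v p "{1..}"] f_inv_into_f[of v p "{1..}"]
    unfolding r_def by (auto simp: bij_betw_def)
  have r_inj: "r u \<noteq> r v" if "u \<in> S_A" "v \<in> S_A" "u \<noteq> v" for u v
    using r that by metis
  have free: "\<not> (r x < r (x + d) \<and> r (x + d) < r (x + 2 * d))"
    "\<not> (r (x + 2 * d) < r (x + d) \<and> r (x + d) < r x)"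
    if "x \<in> S_A" "x + d \<in> S_A" "x + 2 * d \<in> S_A" "0 < d" for x d
  proof -
    \<comment> \<open>The reversed progression has difference -d, allowed since
      \<open>three_ap\<close> takes it in the integers.\<close>
    have "three_ap x (x + d) (x + 2 * d)" "three_ap (x + 2 * d) (x + d) x"
      unfolding three_ap_def by (rule exI[of _ "int d"], simp) (rule exI[of _ "- int d"], simp)
    moreover have "\<not> (three_ap (p i) (p j) (p k) \<and>
        (p i < p j \<and> p j < p k \<or> p i > p j \<and> p j > p k))"
      if "1 \<le> i" "i < j" "j < k" for i j k
      using perm that unfolding three_ap_free_perm_def by blast
    note this[of "r x" "r (x + d)" "r (x + 2 * d)"] this[of "r (x + 2 * d)" "r (x + d)" "r x"]
    ultimately show "\<not> (r x < r (x + d) \<and> r (x + d) < r (x + 2 * d))"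
      "\<not> (r (x + 2 * d) < r (x + d) \<and> r (x + d) < r x)"
      using r that by auto
  qed
  \<comment> \<open>The blocks are open on the left, so the multipliers start at 5 and 17, not at 4
    and 16.\<close>
  have inS: "i * e \<in> S_A" if "17 \<le> i \<and> i \<le> 32 \<or> 5 \<le> i \<and> i \<le> 8" for i
  proof -
    have "i * e \<in> {4 * e<..8 * e} \<union> {16 * e<..32 * e}"
      using that e by auto
    then show ?thesis
      using sub by blast
  qed
  have ne: "r (17 * e) \<noteq> r (24 * e)" "r (17 * e) \<noteq> r (19 * e)"
    using r_inj inS e by simp_all
  have mid: "r (x * e) < r ((x + d) * e) \<and> r ((x + 2 * d) * e) < r ((x + d) * e) \<or>
      r ((x + d) * e) < r (x * e) \<and> r ((x + d) * e) < r ((x + 2 * d) * e)"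
    if "17 \<le> x" "0 < d" "x + 2 * d \<le> 32" for x d
  proof -
    have S: "x * e \<in> S_A" "(x + d) * e \<in> S_A" "(x + 2 * d) * e \<in> S_A"
      using that by (auto intro!: inS)
    moreover have "r (x * e) \<noteq> r ((x + d) * e)" "r ((x + d) * e) \<noteq> r ((x + 2 * d) * e)"
      using that e S by (simp_all add: r_inj)
    ultimately show ?thesis
      using free[of "x * e" "d * e"] that e by (auto simp: algebra_simps)
  qed
  \<comment> \<open>The subtractions are not truncated, since a \<le> 8 < 17 \<le> b.\<close>
  have low: "\<not> (r (a * e) < r (b * e) \<and> r (b * e) < r ((2 * b - a) * e))"
    "\<not> (r ((2 * b - a) * e) < r (b * e) \<and> r (b * e) < r (a * e))"
    "r (b * e) \<noteq> r ((2 * b - a) * e)"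
    if "5 \<le> a" "a \<le> 8" "17 \<le> b" "2 * b - a \<le> 32" for a b
  proof -
    have S: "a * e \<in> S_A" "b * e \<in> S_A" "(2 * b - a) * e \<in> S_A"
      using that by (auto intro!: inS)
    have "a * e + (b - a) * e = b * e" "a * e + 2 * ((b - a) * e) = (2 * b - a) * e"
      using that by (auto simp: algebra_simps)
    then show "\<not> (r (a * e) < r (b * e) \<and> r (b * e) < r ((2 * b - a) * e))"
      "\<not> (r ((2 * b - a) * e) < r (b * e) \<and> r (b * e) < r (a * e))"
      using free[of "a * e" "(b - a) * e"] S that e by auto
    show "r (b * e) \<noteq> r ((2 * b - a) * e)"
      using S that e by (intro r_inj) auto
  qed
  have "{4 * e<..8 * e} \<inter> {16 * e<..32 * e} = {}"
    by auto
  then consider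
      (before) "\<And>i j. \<lbrakk>1 \<le> i; 1 \<le> j; p i \<in> {4 * e<..8 * e}; p j \<in> {16 * e<..32 * e}\<rbrakk> \<Longrightarrow> i < j"
    | (after) "\<And>i j. \<lbrakk>1 \<le> i; 1 \<le> j; p i \<in> {4 * e<..8 * e}; p j \<in> {16 * e<..32 * e}\<rbrakk> \<Longrightarrow> j < i"
    using contiguous_runs_ordered[OF cont] unfolding L H by blast
  then show False
  proof cases
    case before
    have first: "r (a * e) < r (b * e)" if "5 \<le> a" "a \<le> 8" "17 \<le> b" "b \<le> 32" for a b
      using that e r inS[of a] inS[of b] by (intro before) auto
    have "r ((2 * b - a) * e) < r (b * e)" if "5 \<le> a" "a \<le> 8" "17 \<le> b" "2 * b - a \<le> 32" for a b
      using low[OF that] first[of a b] that by linarith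
    with ne mid show False
      by (intro no_ranking[of "\<lambda>i. int (r (i * e))"]) auto
  next
    case after
    have second: "r (b * e) < r (a * e)" if "5 \<le> a" "a \<le> 8" "17 \<le> b" "b \<le> 32" for a b
      using that e r inS[of a] inS[of b] by (intro after) auto
    have "r (b * e) < r ((2 * b - a) * e)" if "5 \<le> a" "a \<le> 8" "17 \<le> b" "2 * b - a \<le> 32" for a b
      using low[OF that] second[of a b] that by linarith
    \<comment> \<open>Negating positions reverses \<open>low\<close> and only swaps the two
      alternatives of \<open>mid\<close>, so the same lemma applies.\<close>
    then show False
      by (intro no_ranking[of "\<lambda>i. - int (r (i * e))"]) (use ne mid in \<open>simp_all add: disj_commute\<close>)
  qed
qed

theorem theorem14:
  fixes p :: "nat \<Rightarrow> nat"
  assumes "three_ap_free_perm p S_A"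
  shows "infinite {k. 1 \<le> k \<and> \<not> contiguous_run p (block (2 * k))}"
proof
  assume "finite {k. 1 \<le> k \<and> \<not> contiguous_run p (block (2 * k))}"
  then obtain N where N: "\<forall>k \<in> {k. 1 \<le> k \<and> \<not> contiguous_run p (block (2 * k))}. k \<le> N"
    unfolding finite_nat_set_iff_bounded_le by blast
  \<comment> \<open>Both indices exceed the bound \<open>N\<close> on the exceptions.\<close>
  have "contiguous_run p (block (2 * (N + 2)))" "contiguous_run p (block (2 * (N + 3)))"
    using bspec[OF N, of "N + 2"] bspec[OF N, of "N + 3"] by auto
  then show False
    by (rule consecutive_blocks_not_both_contiguous[OF assms])
qed

end
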